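(* Let $a,b\ge 0$, $h_t>0$, let $N_t,N_x$ be positive integers and set $n=N_x^2$. Let $\mathcal G_h,\mathcal L_h\in\mathbb R^{n\times n}$ be self-adjoint and positive semidefinite, and let $\mathcal G_h$ have the spectral decomposition $$\mathcal G_h=\begin{bmatrix}Q_1&Q_2\end{bmatrix}\begin{bmatrix}\Lambda&\\&O\end{bmatrix}\begin{bmatrix}Q_1^\top\\Q_2^\top\end{bmatrix},$$ with $[Q_1\,|\,Q_2]$ orthogonal, $\Lambda=\mathrm{diag}(\lambda_1,\dots,\lambda_r)$, $\lambda_1\ge\dots\ge\lambda_r>0$, $r=\mathrm{rank}(\mathcal G_h)$. Let $f\in C^1(\mathbb R)$ be decomposed as $f=W'+\phi$, where $W\in C^1(\mathbb R)$ is convex and $\phi\in C(\mathbb R)$ is Lipschitz with Lipschitz constant $\mathrm{Lip}(\phi)$, and suppose that for some $K\ge 0$ $$(W'(x)-W'(y))(x-y)\ge K|x-y|^2\quad\text{for all }x,y\in\mathbb R.$$ If $h_t$ satisfies $$\lambda_{\min}\Big(\frac{\Lambda^{-1}}{h_t}+a\,Q_1^\top\mathcal L_hQ_1\Big)+bK>b\,\mathrm{Lip}(\phi),$$ then the root-finding problem $F(U)=0$, $U\in\mathbb R^{N_tn}$, admits a unique solution, where $F$ is the map of the time-implicit scheme defined in the context.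
   Context: Write $U=[(u^1)^\top,\dots,(u^{N_t})^\top]^\top\in\mathbb R^{N_tn}$ with $u^t\in\mathbb R^n$, $n=N_x^2$. The map $F:\mathbb R^{N_tn}\to\mathbb R^{N_tn}$ is $$F(U)=\mathscr D U+h_t\mathscr G_h\,(a\mathscr L_hU+bf(U))-V,$$ where $f$ acts entrywise, $\mathscr D=D_{N_t}\otimes I_n$ with $D_{N_t}$ the $N_t\times N_t$ matrix having $1$ on the diagonal, $-1$ on the first subdiagonal and $0$ elsewhere, $\mathscr G_h=I_{N_t}\otimes\mathcal G_h$, $\mathscr L_h=I_{N_t}\otimes\mathcal L_h$, and $V\in\mathbb R^{N_tn}$ is a given constant vector encoding the initial (and boundary) data. $F(U)=0$ encodes the implicit scheme $\frac{u^{t+1}-u^t}{h_t}=-\mathcal G_h(a\mathcal L_hu^{t+1}+bf(u^{t+1}))$ for $0\le t\le N_t-1$ with given $u^0$. $\lambda_{\min}$ denotes the smallest eigenvalue. *)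

theory Defs
  imports
    "HOL-Analysis.Analysis"
    "Jordan_Normal_Form.DL_Rank"
    "Jordan_Normal_Form.Spectral_Radius"
begin

hide_type (open) Finite_Cartesian_Product.vec
hide_const (open) Finite_Cartesian_Product.mat Finite_Cartesian_Product.vec

definition kron :: "real mat \<Rightarrow> real mat \<Rightarrow> real mat" where
  "kron A B = Matrix.mat (dim_row A * dim_row B) (dim_col A * dim_col B)
     (\<lambda>(i, j). A $$ (i div dim_row B, j div dim_col B) * B $$ (i mod dim_row B, j mod dim_col B))"

text \<open>\<open>hcat A B\<close> is the block row \<open>[A B]\<close>; the lower blocks have no rows.\<close>

definition hcat :: "real mat \<Rightarrow> real mat \<Rightarrow> real mat" where
  "hcat A B = four_block_mat A B (0\<^sub>m 0 (dim_col A)) (0\<^sub>m 0 (dim_col B))"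

text \<open>The library's \<open>orthogonal_mat\<close> does not require the columns to be normalised, hence a
  separate notion.\<close>

definition orthonormal_mat :: "real mat \<Rightarrow> bool" where
  "orthonormal_mat Q \<longleftrightarrow> square_mat Q \<and> transpose_mat Q * Q = 1\<^sub>m (dim_col Q)
     \<and> Q * transpose_mat Q = 1\<^sub>m (dim_row Q)"

definition self_adjoint_mat :: "real mat \<Rightarrow> bool" where
  "self_adjoint_mat A \<longleftrightarrow> transpose_mat A = A"

definition pos_semidef_mat :: "real mat \<Rightarrow> bool" where
  "pos_semidef_mat A \<longleftrightarrow> square_mat A
     \<and> (\<forall>v \<in> carrier_vec (dim_row A). 0 \<le> scalar_prod v (A *\<^sub>v v))"

text \<open>The smallest eigenvalue of a matrix with real spectrum. A \<open>0 \<times> 0\<close> matrix has no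
  eigenvalues, and the value is then unspecified.\<close>

definition lambda_min :: "real mat \<Rightarrow> real" where
  "lambda_min A = Min (spectrum A)"

text \<open>The best Lipschitz constant; meaningful only for Lipschitz functions.\<close>

definition Lip :: "(real \<Rightarrow> real) \<Rightarrow> real" where
  "Lip \<phi> = Inf {L. L-lipschitz_on UNIV \<phi>}"

definition time_diff_mat :: "nat \<Rightarrow> real mat" where
  "time_diff_mat Nt = Matrix.mat Nt Nt
     (\<lambda>(i, j). if i = j then 1 else if i = Suc j then -1 else 0)"

text \<open>A space-time vector stacks the \<open>Nt\<close> time levels, each of length \<open>n\<close>: component \<open>i\<close> of
  level \<open>t\<close> (both counted from 0) has index \<open>t * n + i\<close>.\<close>

definition scheme_map ::
  "nat \<Rightarrow> nat \<Rightarrow> real \<Rightarrow> real mat \<Rightarrow> real mat \<Rightarrow> real \<Rightarrow> real \<Rightarrow> (real \<Rightarrow> real) \<Rightarrow> real vec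
    \<Rightarrow> real vec \<Rightarrow> real vec" where
  "scheme_map Nt n ht G L a b f V U =
     kron (time_diff_mat Nt) (1\<^sub>m n) *\<^sub>v U
     + ht \<cdot>\<^sub>v (kron (1\<^sub>m Nt) G *\<^sub>v (a \<cdot>\<^sub>v (kron (1\<^sub>m Nt) L *\<^sub>v U) + b \<cdot>\<^sub>v map_vec f U))
     - V"

end

(* The scheme is block lower bidiagonal in time, so it is solved level by level, each level asking
   for u + ht G (a L u + b f(u)) = c. Since u - c lies in the range of G, put u = c + Q1 w; the
   equation becomes
     (Lambda^-1 / ht + a Q1^T L Q1) w + a Q1^T L c + b Q1^T f(c + Q1 w) = 0.
   The left-hand side is the gradient of a function of w, and the condition on ht together with
   (f x - f y) (x - y) >= (K - Lip phi) (x - y)^2 makes it strongly monotone. Hence the function is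
   coercive, its minimiser solves the equation, and the solution is unique. *)

theory Submission
  imports Defs
begin

unbundle no vec_syntax and no inner_syntax

subsection \<open>Rayleigh quotients and strongly monotone gradients\<close>

text \<open>Composing \<open>G\<close> with the gradient \<open>a L u + b f(u)\<close> in general
  destroys both the gradient structure and monotonicity for the Euclidean inner product, and a
  kernel of \<open>G\<close> forbids dividing by it. In coordinates on the range of \<open>G\<close>
  the factor is the invertible diagonal \<open>\<Lambda>\<close>; after dividing by it, the
  remaining terms are compressed by \<open>Q1\<close> on the right and its transpose on the left,
  which preserves gradients. The constant \<open>K - Lip \<phi>\<close> may be negative, so the
  nonlinearity alone need not be monotone. Since \<open>Q1\<close> has orthonormal columns,
  \<open>Q1 w\<close> and \<open>w\<close> have the same length. The contribution of
  \<open>b f\<close> is therefore bounded below by exactly \<open>b * (K - Lip \<phi>)\<close> times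
  the squared length of the difference in \<open>w\<close>, whatever the sign, and can be added to
  the smallest eigenvalue.\<close>

lemma scalar_prod_self_nonneg: "0 \<le> v \<bullet> (v :: real vec)"
  by (simp add: scalar_prod_def sum_nonneg)

lemma scalar_prod_self_eq_0:
  fixes v :: "real vec"
  assumes "v \<in> carrier_vec n" and "v \<bullet> v = 0"
  shows "v = 0\<^sub>v n"
proof (rule eq_vecI)
  fix i assume i: "i < dim_vec (0\<^sub>v n)"
  have "\<forall>i\<in>{0..<n}. v $ i * v $ i = 0"
    using assms by (subst sum_nonneg_eq_0_iff[symmetric]) (auto simp: scalar_prod_def)
  then show "v $ i = 0\<^sub>v n $ i" using i by auto
qed (use assms in auto)

lemma vec_index_sq_le_scalar_prod:
  fixes v :: "real vec"
  assumes "i < dim_vec v"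
  shows "(v $ i)\<^sup>2 \<le> v \<bullet> v"
  unfolding scalar_prod_def power2_eq_square
  by (rule member_le_sum[where f = "\<lambda>i. v $ i * v $ i"]) (use assms in auto)

text \<open>Coordinates from \<open>n\<close> on are pinned to 0, so every factor is compact and
  Tychonoff's theorem applies to the infinite product.\<close>

lemma compact_coordinate_box:
  "compact (PiE UNIV (\<lambda>i::nat. if i < n then {-R..R} else {0::real}))"
proof -
  have "compactin (product_topology (\<lambda>i. euclidean) UNIV)
      (PiE UNIV (\<lambda>i::nat. if i < n then {-R..R} else {0::real}))"
    by (subst compactin_PiE) auto
  then show ?thesis by (simp add: euclidean_product_topology)
qed

text \<open>Topology enters through \<open>x \<mapsto> vec n x\<close> on functions of type
  \<open>nat \<Rightarrow> real\<close>; continuity of \<open>J\<close> and closedness of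
  \<open>S\<close> are stated there. Extension by zero is a section of this map, so \<open>S\<close>
  is the image of a closed subset of a compact box.\<close>

lemma vec_attains_inf:
  fixes J :: "real vec \<Rightarrow> real"
  assumes cont: "continuous_on UNIV (\<lambda>x. J (vec n x))"
    and closed: "closed {x. vec n x \<in> S}"
    and S: "S \<subseteq> carrier_vec n" "S \<noteq> {}"
    and bound: "\<And>v i. v \<in> S \<Longrightarrow> i < n \<Longrightarrow> \<bar>v $ i\<bar> \<le> R"
  shows "\<exists>v\<in>S. \<forall>w\<in>S. J v \<le> J w"
proof -
  define B where "B = PiE UNIV (\<lambda>i::nat. if i < n then {-R..R} else {0::real})"
  define X where "X = B \<inter> {x. vec n x \<in> S}"
  define c where "c v = (\<lambda>i. if i < n then v $ i else 0)" for v :: "real vec"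
  have c: "c v \<in> X" "vec n (c v) = v" if "v \<in> S" for v
  proof -
    show *: "vec n (c v) = v" using that S by (intro eq_vecI) (auto simp: c_def)
    have "c v \<in> B" using bound[OF that] by (force simp: PiE_iff abs_le_iff B_def c_def)
    then show "c v \<in> X" using that * by (simp add: X_def)
  qed
  have "compact X"
    unfolding X_def B_def using compact_coordinate_box closed by (rule compact_Int_closed)
  moreover have "X \<noteq> {}" using c S by blast
  ultimately have "\<exists>x\<in>X. \<forall>y\<in>X. J (vec n x) \<le> J (vec n y)"
    by (rule continuous_attains_inf) (rule continuous_on_subset[OF cont subset_UNIV])
  then obtain x where x: "x \<in> X" "\<And>y. y \<in> X \<Longrightarrow> J (vec n x) \<le> J (vec n y)"
    by (elim bexE) simp
  have "J (vec n x) \<le> J w" if "w \<in> S" for w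
    using x(2)[OF c(1)[OF that]] c(2)[OF that] by simp
  then show ?thesis using x(1) by (auto simp: X_def)
qed

lemma continuous_on_scalar_prod_self: "continuous_on UNIV (\<lambda>x. vec n x \<bullet> (vec n x :: real vec))"
  by (simp add: scalar_prod_def) (intro continuous_intros continuous_on_product_coordinates)

lemma continuous_on_quadratic_form:
  assumes "A \<in> carrier_mat n n"
  shows "continuous_on UNIV (\<lambda>x. vec n x \<bullet> (A *\<^sub>v vec n x :: real vec))"
  using assms
  by (simp add: scalar_prod_def) (intro continuous_intros continuous_on_product_coordinates)

text \<open>Symmetry merges the two cross terms. The expansion serves the variation of the Rayleigh
  quotient and the differentiation of the energy along lines; with the identity matrix it expands a
  squared norm.\<close>

lemma quadratic_form_line:
  fixes M :: "real mat"
  assumes M: "M \<in> carrier_mat n n" and sym: "transpose_mat M = M"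
    and v: "v \<in> carrier_vec n" and w: "w \<in> carrier_vec n"
  shows "(v + t \<cdot>\<^sub>v w) \<bullet> (M *\<^sub>v (v + t \<cdot>\<^sub>v w))
    = v \<bullet> (M *\<^sub>v v) + 2 * t * (w \<bullet> (M *\<^sub>v v)) + t\<^sup>2 * (w \<bullet> (M *\<^sub>v w))"
proof -
  have "v \<bullet> (M *\<^sub>v w) = w \<bullet> (M *\<^sub>v v)"
    using transpose_vec_mult_scalar[OF M w v] M v w comm_scalar_prod[of "M *\<^sub>v v" n w]
    by (simp add: sym)
  moreover have "M *\<^sub>v (v + t \<cdot>\<^sub>v w) = M *\<^sub>v v + t \<cdot>\<^sub>v (M *\<^sub>v w)"
    using M v w by (simp add: mult_add_distrib_mat_vec mult_mat_vec)
  ultimately show ?thesis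
    using M v w
    by (simp add: add_scalar_prod_distrib[of _ n] scalar_prod_add_distrib[of _ n]
        power2_eq_square algebra_simps)
qed

text \<open>First-order condition: the polynomial is 0 at \<open>t = 0\<close>, so it has a minimum
  there, and its derivative at that point is \<open>2 * p\<close>.\<close>

lemma linear_term_zero:
  fixes p q :: real
  assumes "\<And>t. 0 \<le> 2 * t * p + t\<^sup>2 * q"
  shows "p = 0"
proof -
  have "((\<lambda>t. 2 * t * p + t\<^sup>2 * q) has_real_derivative 2 * p) (at 0)"
    by (auto intro!: derivative_eq_intros)
  then have "2 * p = 0"
    by (rule DERIV_local_min[where d = 1]) (use assms in auto)
  then show ?thesis by simp
qed

text \<open>A minimiser of the Rayleigh quotient on the unit sphere is an eigenvector.\<close>

lemma lambda_min_le_quadratic_form: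
  fixes M :: "real mat"
  assumes M: "M \<in> carrier_mat n n" and sym: "transpose_mat M = M" and v: "v \<in> carrier_vec n"
  shows "lambda_min M * (v \<bullet> v) \<le> v \<bullet> (M *\<^sub>v v)"
\<comment> \<open>The first case also disposes of \<open>n = 0\<close>, where
  \<open>lambda_min\<close> is unspecified. In the other case \<open>v\<close> itself shows that the
  unit sphere is nonempty.\<close>
proof (cases "v \<bullet> v = 0")
  case True
  then have "v = 0\<^sub>v n" using scalar_prod_self_eq_0 v by blast
  then show ?thesis using True M by simp
next
  case False
  let ?S = "{v \<in> carrier_vec n. v \<bullet> v = (1::real)}"
  have normalize: "\<exists>s>0. s * s * (u \<bullet> u) = 1 \<and> s \<cdot>\<^sub>v u \<in> ?S" if u: "u \<in> carrier_vec n" "u \<bullet> u \<noteq> 0" for u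
  proof -
    have pos: "u \<bullet> u > 0" using u scalar_prod_self_nonneg[of u] by linarith
    let ?s = "1 / sqrt (u \<bullet> u)"
    have "?s * ?s * (u \<bullet> u) = 1" using pos by (simp add: field_simps)
    then show ?thesis using pos u by (intro exI[of _ ?s]) (simp add: algebra_simps)
  qed
  have "?S \<noteq> {}" using normalize[OF v False] by blast
  moreover have "closed {x. vec n x \<in> ?S}"
    using continuous_closed_preimage_constant[OF continuous_on_scalar_prod_self[of n] closed_UNIV, of 1]
    by simp
  moreover have "\<bar>u $ i\<bar> \<le> 1" if "u \<in> ?S" "i < n" for u i
    using vec_index_sq_le_scalar_prod[of i u] that by (auto simp: abs_square_le_1)
  ultimately obtain e where e: "e \<in> ?S" and min: "\<And>w. w \<in> ?S \<Longrightarrow> e \<bullet> (M *\<^sub>v e) \<le> w \<bullet> (M *\<^sub>v w)"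
    using vec_attains_inf[OF continuous_on_quadratic_form[OF M], of ?S 1] by blast
  define \<mu> where "\<mu> = e \<bullet> (M *\<^sub>v e)"
  have e': "e \<in> carrier_vec n" "e \<bullet> e = 1" using e by auto
  have rayleigh: "\<mu> * (u \<bullet> u) \<le> u \<bullet> (M *\<^sub>v u)" if u: "u \<in> carrier_vec n" for u
  proof (cases "u \<bullet> u = 0")
    case True
    then have "u = 0\<^sub>v n" using scalar_prod_self_eq_0 u by blast
    then show ?thesis using True M by simp
  next
    case False
    obtain s where s: "s > 0" "s * s * (u \<bullet> u) = 1" "s \<cdot>\<^sub>v u \<in> ?S"
      using normalize[OF u False] by blast
    have "s * s * (\<mu> * (u \<bullet> u)) = \<mu>" using s(2) by (simp add: algebra_simps)
    also have "\<dots> \<le> (s \<cdot>\<^sub>v u) \<bullet> (M *\<^sub>v (s \<cdot>\<^sub>v u))" unfolding \<mu>_def by (rule min[OF s(3)])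
    also have "\<dots> = s * s * (u \<bullet> (M *\<^sub>v u))"
      using M u by (simp add: mult_mat_vec)
    finally show ?thesis using s(1) by simp
  qed
  \<comment> \<open>The residual of the eigenvector equation serves as its own direction of
    variation: the first-order condition at \<open>e\<close> along \<open>w\<close> then reads
    \<open>w \<bullet> w = 0\<close>.\<close>
  define w where "w = M *\<^sub>v e - \<mu> \<cdot>\<^sub>v e"
  have w: "w \<in> carrier_vec n" using M e' by (simp add: w_def)
  have "w \<bullet> (M *\<^sub>v e) - \<mu> * (w \<bullet> e) = 0"
  proof (rule linear_term_zero)
    fix t
    have "(e + t \<cdot>\<^sub>v w) \<bullet> (e + t \<cdot>\<^sub>v w) = 1 + 2 * t * (w \<bullet> e) + t\<^sup>2 * (w \<bullet> w)"
      using quadratic_form_line[of "1\<^sub>m n" n e w t] e' w by simp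
    then show "0 \<le> 2 * t * (w \<bullet> (M *\<^sub>v e) - \<mu> * (w \<bullet> e)) + t\<^sup>2 * (w \<bullet> (M *\<^sub>v w) - \<mu> * (w \<bullet> w))"
      using rayleigh[of "e + t \<cdot>\<^sub>v w"] quadratic_form_line[OF M sym e'(1) w, of t] e' w
      by (simp add: \<mu>_def[symmetric] algebra_simps)
  qed
  moreover have "w \<bullet> (M *\<^sub>v e) - \<mu> * (w \<bullet> e) = w \<bullet> w"
    using M e' w by (subst (4) w_def) (simp add: scalar_prod_minus_distrib[of _ n])
  ultimately have "w = 0\<^sub>v n" using scalar_prod_self_eq_0 w by metis
  have "M *\<^sub>v e = \<mu> \<cdot>\<^sub>v e"
  proof (rule eq_vecI)
    fix i assume "i < dim_vec (\<mu> \<cdot>\<^sub>v e)"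
    then show "(M *\<^sub>v e) $ i = (\<mu> \<cdot>\<^sub>v e) $ i"
      using arg_cong[OF \<open>w = 0\<^sub>v n\<close>, of "\<lambda>x. x $ i"] M e' by (simp add: w_def)
  qed (use M e' in auto)
  moreover have "e \<noteq> 0\<^sub>v n" using e' by auto
  ultimately have "\<mu> \<in> spectrum M"
    using M e' by (auto simp: spectrum_def eigenvalue_def eigenvector_def)
  then have "lambda_min M \<le> \<mu>"
    unfolding lambda_min_def using card_finite_spectrum[OF M] by simp
  then have "lambda_min M * (v \<bullet> v) \<le> \<mu> * (v \<bullet> v)"
    using scalar_prod_self_nonneg by (rule mult_right_mono)
  then show ?thesis using rayleigh[OF v] by linarith
qed

text \<open>\<open>T\<close> has to be a gradient only along lines. Strong monotonicity integrates
  to a quadratic lower bound for \<open>J\<close>, which keeps \<open>J\<close> above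
  \<open>J(0)\<close> outside a ball; a minimiser over the ball is therefore global.\<close>

lemma strongly_monotone_gradient_has_zero:
  fixes J :: "real vec \<Rightarrow> real" and T :: "real vec \<Rightarrow> real vec"
  assumes T: "\<And>w. w \<in> carrier_vec n \<Longrightarrow> T w \<in> carrier_vec n"
    and cont: "continuous_on UNIV (\<lambda>x. J (vec n x))"
    and deriv: "\<And>w h t. w \<in> carrier_vec n \<Longrightarrow> h \<in> carrier_vec n \<Longrightarrow>
        ((\<lambda>t. J (w + t \<cdot>\<^sub>v h)) has_real_derivative T (w + t \<cdot>\<^sub>v h) \<bullet> h) (at t)"
    and c: "c > 0"
    and mono: "\<And>w w'. w \<in> carrier_vec n \<Longrightarrow> w' \<in> carrier_vec n \<Longrightarrow>
        c * ((w - w') \<bullet> (w - w')) \<le> (T w - T w') \<bullet> (w - w')"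
  shows "\<exists>w\<in>carrier_vec n. T w = 0\<^sub>v n"
proof -
  define g where "g = T (0\<^sub>v n)"
  have g: "g \<in> carrier_vec n" using T by (simp add: g_def)
  have strong: "J (0\<^sub>v n) + g \<bullet> w + c / 2 * (w \<bullet> w) \<le> J w" if w: "w \<in> carrier_vec n" for w
  proof -
    \<comment> \<open>\<open>\<psi>\<close> is \<open>J\<close> along the segment from 0 to
      \<open>w\<close>, less the linear and quadratic terms of the claimed bound, so the bound says
      \<open>\<psi> 0 \<le> \<psi> 1\<close>.\<close>
    define \<psi> where "\<psi> t = J (0\<^sub>v n + t \<cdot>\<^sub>v w) - t * (g \<bullet> w) - t\<^sup>2 * (c / 2 * (w \<bullet> w))" for t
    have "\<psi> 0 \<le> \<psi> 1"
    proof (rule DERIV_nonneg_imp_nondecreasing[where f = \<psi> and a = 0 and b = 1])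
      fix t :: real assume t: "0 \<le> t" "t \<le> 1"
      have tw: "t \<cdot>\<^sub>v w \<in> carrier_vec n" using w by simp
      let ?D = "T (0\<^sub>v n + t \<cdot>\<^sub>v w) \<bullet> w - g \<bullet> w - 2 * t * (c / 2 * (w \<bullet> w))"
      have "(\<psi> has_real_derivative ?D) (at t)"
        unfolding \<psi>_def by (rule derivative_eq_intros deriv refl w zero_carrier_vec | simp)+
      moreover have "0 \<le> ?D"
      \<comment> \<open>Monotonicity between \<open>t w\<close> and 0 carries a factor
        \<open>t\<close> on both sides that cancels only for \<open>t > 0\<close>; at
        \<open>t = 0\<close> the derivative is 0.\<close>
      proof (cases "t = 0")
        case True
        have "0\<^sub>v n + 0 \<cdot>\<^sub>v w = 0\<^sub>v n" using w by (intro eq_vecI) auto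
        then show ?thesis using True by (simp add: g_def)
      next
        case False
        have "t * (c * t * (w \<bullet> w)) \<le> t * ((T (t \<cdot>\<^sub>v w) - g) \<bullet> w)"
          using mono[OF tw zero_carrier_vec] w g T[OF tw] by (simp add: g_def[symmetric] algebra_simps)
        then have "c * t * (w \<bullet> w) \<le> (T (t \<cdot>\<^sub>v w) - g) \<bullet> w"
          using False t by simp
        then show ?thesis
          using w g T[OF tw] by (simp add: minus_scalar_prod_distrib[of _ n] algebra_simps)
      qed
      ultimately show "\<exists>y. (\<psi> has_real_derivative y) (at t) \<and> 0 \<le> y" by blast
    qed simp
    moreover have "0\<^sub>v n + 0 \<cdot>\<^sub>v w = 0\<^sub>v n" "0\<^sub>v n + 1 \<cdot>\<^sub>v w = w" using w by auto
    ultimately show ?thesis by (simp add: \<psi>_def)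
  qed
  \<comment> \<open>The term \<open>c / 2 * (v \<bullet> v)\<close> dominates
    \<open>g \<bullet> v\<close> once the norm of \<open>v\<close> is at least twice the norm of
    \<open>g\<close> divided by \<open>c\<close>; \<open>\<rho>\<close> is the square of this
    radius.\<close>
  define \<rho> where "\<rho> = 4 * (g \<bullet> g) / c\<^sup>2"
  have \<rho>: "\<rho> \<ge> 0" using scalar_prod_self_nonneg by (simp add: \<rho>_def)
  let ?S = "{w \<in> carrier_vec n. w \<bullet> w \<le> \<rho>}"
  have zero: "0\<^sub>v n \<in> ?S" using \<rho> by simp
  have "closed {x. vec n x \<in> ?S}"
    using continuous_on_closed_Collect_le[OF continuous_on_scalar_prod_self[of n] continuous_on_const closed_UNIV, of \<rho>]
    by simp
  moreover have "\<bar>u $ i\<bar> \<le> sqrt \<rho>" if "u \<in> ?S" "i < n" for u i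
    using vec_index_sq_le_scalar_prod[of i u] that by (auto intro!: real_le_rsqrt)
  ultimately obtain w where w: "w \<in> ?S" and min: "\<And>v. v \<in> ?S \<Longrightarrow> J w \<le> J v"
    using vec_attains_inf[OF cont, of ?S "sqrt \<rho>"] zero by blast
  have w': "w \<in> carrier_vec n" using w by simp
  have global: "J w \<le> J v" if v: "v \<in> carrier_vec n" for v
  proof (cases "v \<in> ?S")
    case False
    then have "4 * (g \<bullet> g) < c\<^sup>2 * (v \<bullet> v)" using v c by (simp add: \<rho>_def field_simps)
    \<comment> \<open>Expanding the squared norm of \<open>2 g + c v\<close> takes the place of the
      Cauchy-Schwarz inequality and avoids square roots.\<close>
    moreover have "0 \<le> 4 * (g \<bullet> g) + 4 * c * (g \<bullet> v) + c\<^sup>2 * (v \<bullet> v)"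
      using scalar_prod_self_nonneg[of "2 \<cdot>\<^sub>v g + c \<cdot>\<^sub>v v"] g v comm_scalar_prod[OF v g]
      by (simp add: add_scalar_prod_distrib[of _ n] scalar_prod_add_distrib[of _ n]
          power2_eq_square algebra_simps)
    ultimately have "0 \<le> c * (4 * (g \<bullet> v) + 2 * c * (v \<bullet> v))"
      by (simp add: power2_eq_square algebra_simps)
    then have "0 \<le> g \<bullet> v + c / 2 * (v \<bullet> v)" using c by (simp add: zero_le_mult_iff)
    then have "J (0\<^sub>v n) \<le> J v" using strong[OF v] by linarith
    then show ?thesis using min[OF zero] by linarith
  qed (rule min)
  \<comment> \<open>The gradient itself is the test direction, so the vanishing directional
    derivative is the squared norm of \<open>T w\<close>.\<close>
  define h where "h = T w"
  have h: "h \<in> carrier_vec n" using T w' by (simp add: h_def)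
  have w0: "w + 0 \<cdot>\<^sub>v h = w" using w' h by auto
  have "T (w + 0 \<cdot>\<^sub>v h) \<bullet> h = 0"
    by (rule DERIV_local_min[where d = 1, OF deriv[OF w' h]]) (use global w' h w0 in auto)
  then have "T w = 0\<^sub>v n" using scalar_prod_self_eq_0[OF h] w0 by (simp add: h_def)
  then show ?thesis using w' by blast
qed

subsection \<open>One time step\<close>

text \<open>For \<open>x \<noteq> y\<close> the difference quotient is a lower bound of the nonempty
  set of admissible constants, hence at most its infimum.\<close>

lemma lipschitz_Lip:
  assumes "\<exists>C. C-lipschitz_on UNIV \<phi>"
  shows "\<bar>\<phi> x - \<phi> y\<bar> \<le> Lip \<phi> * \<bar>x - y\<bar>"
proof (cases "x = y")
  case False
  have "\<bar>\<phi> x - \<phi> y\<bar> / \<bar>x - y\<bar> \<le> Lip \<phi>"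
    unfolding Lip_def
  proof (rule cInf_greatest)
    fix C assume "C \<in> {L. L-lipschitz_on UNIV \<phi>}"
    then show "\<bar>\<phi> x - \<phi> y\<bar> / \<bar>x - y\<bar> \<le> C"
      using lipschitz_onD[of C UNIV \<phi> x y] False by (simp add: dist_real_def field_simps)
  qed (use assms in blast)
  then show ?thesis using False by (simp add: field_simps)
qed simp

section \<open>Diagonal inverses and the spectral decomposition\<close>

lemma mat_diag_mult_vec:
  assumes "v \<in> carrier_vec n"
  shows "mat_diag n d *\<^sub>v v = vec n (\<lambda>i. d i * v $ i :: 'a :: comm_ring_1)"
proof (rule eq_vecI)
  fix i assume "i < dim_vec (vec n (\<lambda>i. d i * v $ i))"
  then show "(mat_diag n d *\<^sub>v v) $ i = vec n (\<lambda>i. d i * v $ i) $ i"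
    using assms by (simp add: mat_diag_def scalar_prod_def mult_delta_left)
qed (simp add: mat_diag_def)

text \<open>The explicit two-sided inverse makes the matrix a unit, which excludes the result
  \<open>None\<close>; uniqueness of inverses then identifies the value.\<close>

lemma mat_inverse_mat_diag:
  fixes d :: "nat \<Rightarrow> 'a :: field"
  assumes "\<And>i. i < n \<Longrightarrow> d i \<noteq> 0"
  shows "the (mat_inverse (mat_diag n d)) = mat_diag n (\<lambda>i. 1 / d i)"
proof -
  let ?A = "mat_diag n d" and ?D = "mat_diag n (\<lambda>i. 1 / d i)"
  have AD: "?A * ?D = 1\<^sub>m n" and DA: "?D * ?A = 1\<^sub>m n"
    using assms unfolding mat_diag_diag by (auto simp: mat_diag_def intro!: eq_matI)
  have A: "?A \<in> carrier_mat n n" and D: "?D \<in> carrier_mat n n" by auto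
  have "?A \<in> Units (ring_mat TYPE('a) n ())"
    unfolding Units_def ring_mat_def using AD DA A D
    by (auto simp del: mat_diag_diag intro!: bexI[of _ ?D])
  then obtain B where B: "mat_inverse ?A = Some B"
    using mat_inverse(1)[OF A, where b = "()"] by (cases "mat_inverse ?A") auto
  note inv = mat_inverse(2)[OF A B]
  have "B = B * 1\<^sub>m n" using inv right_mult_one_mat by metis
  also have "\<dots> = B * (?A * ?D)" unfolding AD ..
  also have "\<dots> = (B * ?A) * ?D" using assoc_mult_mat[OF _ A D] inv by metis
  also have "\<dots> = ?D" using inv left_mult_one_mat[OF D] by metis
  finally show ?thesis using B by simp
qed

lemma hcat_carrier:
  "A \<in> carrier_mat n r \<Longrightarrow> B \<in> carrier_mat n m \<Longrightarrow> hcat A B \<in> carrier_mat n (r + m)"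
  unfolding hcat_def by auto

text \<open>The first \<open>r\<close> columns of \<open>hcat A B\<close> are those of
  \<open>A\<close>, so the Gram matrix of \<open>A\<close> is the leading block of the full
  one.\<close>

lemma orthonormal_hcat:
  assumes A: "A \<in> carrier_mat n r" and B: "B \<in> carrier_mat n m"
    and orth: "orthonormal_mat (hcat A B)"
  shows "transpose_mat A * A = 1\<^sub>m r"
proof -
  have c: "hcat A B \<in> carrier_mat n (r + m)" using A B by (rule hcat_carrier)
  then have eq: "transpose_mat (hcat A B) * hcat A B = 1\<^sub>m (r + m)"
    using orth by (simp add: orthonormal_mat_def)
  show "transpose_mat A * A = 1\<^sub>m r"
  proof (rule eq_matI)
    fix i j assume ij: "i < dim_row (1\<^sub>m r)" "j < dim_col (1\<^sub>m r)"
    have col: "col (hcat A B) k = col A k" if "k < r" for k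
      using that A B by (auto simp: hcat_def col_def intro!: eq_vecI)
    have "(transpose_mat (hcat A B) * hcat A B) $$ (i, j) = col A i \<bullet> col A j"
      using ij c by (simp add: col)
    then show "(transpose_mat A * A) $$ (i, j) = 1\<^sub>m r $$ (i, j)"
      using ij A by (simp add: eq)
  qed (use A in auto)
qed

text \<open>Reduces the spectral decomposition to its nonzero part. Both outer factors are block
  matrices with empty blocks, so the block product rule applies, and the final product has a single
  nonempty block.\<close>

lemma hcat_block_diag_product:
  assumes A: "A \<in> carrier_mat n r" and B: "B \<in> carrier_mat n m" and D: "D \<in> carrier_mat r r"
  shows "hcat A B * four_block_mat D (0\<^sub>m r m) (0\<^sub>m m r) (0\<^sub>m m m)
      * (transpose_mat A @\<^sub>r transpose_mat B) = A * D * transpose_mat A"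
proof -
  have "hcat A B * four_block_mat D (0\<^sub>m r m) (0\<^sub>m m r) (0\<^sub>m m m)
    = four_block_mat (A * D) (0\<^sub>m n m) (0\<^sub>m 0 r) (0\<^sub>m 0 m)"
    unfolding hcat_def
    by (subst mult_four_block_mat[where ?nr1.0 = n and ?nr2.0 = 0 and ?n1.0 = r and ?n2.0 = m
          and ?nc1.0 = r and ?nc2.0 = m]) (use A B D in auto)
  also have "\<dots> * (transpose_mat A @\<^sub>r transpose_mat B)
    = four_block_mat (A * D * transpose_mat A) (0\<^sub>m n 0) (0\<^sub>m 0 n) (0\<^sub>m 0 0)"
    unfolding append_rows_def
    by (subst mult_four_block_mat[where ?nr1.0 = n and ?nr2.0 = 0 and ?n1.0 = r and ?n2.0 = m
          and ?nc1.0 = n and ?nc2.0 = 0]) (use A B D in auto)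
  also have "\<dots> = A * D * transpose_mat A"
    by (rule eq_matI) (use A D in auto)
  finally show ?thesis .
qed

lemma scalar_prod_isometry:
  assumes Q: "Q \<in> carrier_mat n r" and orth: "transpose_mat Q * Q = 1\<^sub>m r"
    and h: "h \<in> carrier_vec r"
  shows "(Q *\<^sub>v h) \<bullet> (Q *\<^sub>v h) = h \<bullet> (h :: real vec)"
proof -
  have "h \<bullet> h = (transpose_mat Q *\<^sub>v (Q *\<^sub>v h)) \<bullet> h"
    using assoc_mult_mat_vec[of "transpose_mat Q" r n Q r h] Q h orth by simp
  also have "\<dots> = (Q *\<^sub>v h) \<bullet> (Q *\<^sub>v h)"
    using transpose_vec_mult_scalar[OF Q h, of "Q *\<^sub>v h"] Q h by simp
  finally show ?thesis by simp
qed

section \<open>The reduced nonlinear equation\<close>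

lemma map_vec_strongly_monotone:
  fixes f :: "real \<Rightarrow> real"
  assumes f: "\<And>x y. \<kappa> * (x - y)\<^sup>2 \<le> (f x - f y) * (x - y)"
    and u: "u \<in> carrier_vec n" and v: "v \<in> carrier_vec n"
  shows "\<kappa> * ((u - v) \<bullet> (u - v)) \<le> (map_vec f u - map_vec f v) \<bullet> (u - v)"
proof -
  have "(\<Sum>i<n. \<kappa> * (u $ i - v $ i)\<^sup>2) \<le> (\<Sum>i<n. (f (u $ i) - f (v $ i)) * (u $ i - v $ i))"
    by (intro sum_mono f)
  then show ?thesis
    using u v by (simp add: scalar_prod_def lessThan_atLeast0 sum_distrib_left power2_eq_square)
qed

lemma continuous_imp_has_antiderivative:
  fixes f :: "real \<Rightarrow> real"
  assumes "continuous_on UNIV f"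
  obtains F where "\<And>x. (F has_real_derivative f x) (at x)"
proof -
  have "\<exists>F. \<forall>x::real. -\<infinity> < ereal x \<longrightarrow> ereal x < \<infinity> \<longrightarrow> (F has_vector_derivative f x) (at x)"
    using assms by (intro einterval_antiderivative) (auto simp: continuous_on_eq_continuous_at)
  then show ?thesis using that by (auto simp: has_real_derivative_iff_has_vector_derivative)
qed

text \<open>\<open>\<kappa>\<close> may be negative; \<open>coercive\<close> is the assumption that
  the quadratic part makes up the deficit. Pairing with \<open>h\<close> moves the transpose of
  \<open>Q\<close> over to \<open>h\<close>, so the componentwise bound for \<open>f\<close> can be
  used on the difference \<open>Q h\<close> of the two arguments.\<close>

lemma semilinear_equation_ex1:
  fixes M Q :: "real mat" and f :: "real \<Rightarrow> real"
  assumes M: "M \<in> carrier_mat r r" and sym: "transpose_mat M = M"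
    and Q: "Q \<in> carrier_mat n r" and c: "c \<in> carrier_vec n" and d: "d \<in> carrier_vec r"
    and f: "continuous_on UNIV f" and b: "b \<ge> 0"
    and mono: "\<And>x y. \<kappa> * (x - y)\<^sup>2 \<le> (f x - f y) * (x - y)"
    and \<delta>: "\<delta> > 0"
    and coercive: "\<And>h. h \<in> carrier_vec r \<Longrightarrow>
      \<delta> * (h \<bullet> h) \<le> h \<bullet> (M *\<^sub>v h) + b * \<kappa> * ((Q *\<^sub>v h) \<bullet> (Q *\<^sub>v h))"
  shows "\<exists>!w. w \<in> carrier_vec r \<and>
    M *\<^sub>v w + d + b \<cdot>\<^sub>v (transpose_mat Q *\<^sub>v map_vec f (c + Q *\<^sub>v w)) = 0\<^sub>v r"
proof -
  define T where "T w = M *\<^sub>v w + d + b \<cdot>\<^sub>v (transpose_mat Q *\<^sub>v map_vec f (c + Q *\<^sub>v w))" for w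
  have T: "T w \<in> carrier_vec r" if "w \<in> carrier_vec r" for w
    using that M Q c d by (simp add: T_def)
  have T_ip: "T w \<bullet> h = (M *\<^sub>v w) \<bullet> h + d \<bullet> h + b * (map_vec f (c + Q *\<^sub>v w) \<bullet> (Q *\<^sub>v h))"
    if "w \<in> carrier_vec r" "h \<in> carrier_vec r" for w h
    using that M Q c d
    by (simp add: T_def add_scalar_prod_distrib[of _ r] transpose_vec_mult_scalar[OF Q])
  have strong: "\<delta> * ((w - w') \<bullet> (w - w')) \<le> (T w - T w') \<bullet> (w - w')"
    if w: "w \<in> carrier_vec r" "w' \<in> carrier_vec r" for w w'
  proof -
    define h where "h = w - w'"
    have h: "h \<in> carrier_vec r" using w by (simp add: h_def)
    define u where "u = c + Q *\<^sub>v w"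
    define u' where "u' = c + Q *\<^sub>v w'"
    have u: "u \<in> carrier_vec n" "u' \<in> carrier_vec n" using w Q c by (auto simp: u_def u'_def)
    have Qh: "u - u' = Q *\<^sub>v h"
      using w Q c by (intro eq_vecI) (auto simp: u_def u'_def h_def scalar_prod_minus_distrib[of _ r])
    have "(T w - T w') \<bullet> h = (M *\<^sub>v w - M *\<^sub>v w') \<bullet> h
        + b * ((map_vec f u - map_vec f u') \<bullet> (Q *\<^sub>v h))"
      using w h u M Q T
      by (simp add: minus_scalar_prod_distrib[of _ r] minus_scalar_prod_distrib[of _ n] T_ip
          u_def[symmetric] u'_def[symmetric] algebra_simps)
    moreover have "M *\<^sub>v w - M *\<^sub>v w' = M *\<^sub>v h"
      using mult_minus_distrib_mat_vec[OF M w] by (simp add: h_def)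
    moreover have "(M *\<^sub>v h) \<bullet> h = h \<bullet> (M *\<^sub>v h)"
      using M h by (intro comm_scalar_prod) auto
    moreover have "b * (\<kappa> * ((Q *\<^sub>v h) \<bullet> (Q *\<^sub>v h))) \<le> b * ((map_vec f u - map_vec f u') \<bullet> (Q *\<^sub>v h))"
      using map_vec_strongly_monotone[OF mono u] b by (simp add: Qh mult_left_mono)
    ultimately show ?thesis
      using coercive[OF h] unfolding h_def[symmetric] by simp
  qed
  obtain F where F: "\<And>x. (F has_real_derivative f x) (at x)"
    using continuous_imp_has_antiderivative[OF f] by blast
  \<comment> \<open>A potential of \<open>T\<close>: by symmetry of \<open>M\<close>, half the
    quadratic form has gradient \<open>M w\<close>, and the chain rule turns the sum of
    antiderivatives into the transpose of \<open>Q\<close> applied to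
    \<open>f(c + Q w)\<close>.\<close>
  define J where "J w = w \<bullet> (M *\<^sub>v w) / 2 + d \<bullet> w + b * (\<Sum>i<n. F ((c + Q *\<^sub>v w) $ i))" for w
  have "\<exists>w\<in>carrier_vec r. T w = 0\<^sub>v r"
  proof (rule strongly_monotone_gradient_has_zero[where J = J and c = \<delta>])
    have contF: "continuous_on UNIV F"
      using F by (intro continuous_at_imp_continuous_on) (blast intro: DERIV_isCont)
    have "continuous_on UNIV (\<lambda>x. (c + Q *\<^sub>v vec r x) $ i)" if "i < n" for i
      using that Q c
      by (simp add: scalar_prod_def) (intro continuous_intros continuous_on_product_coordinates)
    then have "continuous_on UNIV (\<lambda>x. \<Sum>i<n. F ((c + Q *\<^sub>v vec r x) $ i))"
      by (intro continuous_on_sum continuous_on_compose2[OF contF]) auto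
    moreover have "continuous_on UNIV (\<lambda>x. d \<bullet> vec r x)"
      by (simp add: scalar_prod_def) (intro continuous_intros continuous_on_product_coordinates)
    ultimately show "continuous_on UNIV (\<lambda>x. J (vec r x))"
      unfolding J_def
      by (intro continuous_on_add continuous_on_divide continuous_on_mult continuous_on_const
          continuous_on_quadratic_form[OF M]) simp_all
  next
    fix w h :: "real vec" and t :: real
    assume w: "w \<in> carrier_vec r" and h: "h \<in> carrier_vec r"
    define p where "p = c + Q *\<^sub>v w"
    define q where "q = Q *\<^sub>v h"
    have pq: "p \<in> carrier_vec n" "q \<in> carrier_vec n" using w h Q c by (auto simp: p_def q_def)
    have line: "c + Q *\<^sub>v (w + s \<cdot>\<^sub>v h) = p + s \<cdot>\<^sub>v q" for s
      using w h Q c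
      by (intro eq_vecI) (auto simp: p_def q_def scalar_prod_add_distrib[of _ r])
    \<comment> \<open>On a line, \<open>J\<close> is a quadratic polynomial in \<open>s\<close> plus
      values of \<open>F\<close> at affine arguments, so one-variable rules differentiate
      it.\<close>
    have J_line: "J (w + s \<cdot>\<^sub>v h) = (w \<bullet> (M *\<^sub>v w) + 2 * s * (h \<bullet> (M *\<^sub>v w)) + s\<^sup>2 * (h \<bullet> (M *\<^sub>v h))) / 2
        + (d \<bullet> w + s * (d \<bullet> h)) + b * (\<Sum>i<n. F (p $ i + s * q $ i))" for s
      unfolding J_def line quadratic_form_line[OF M sym w h]
      using w h d pq by (simp add: scalar_prod_add_distrib[of _ r])
    have "((\<lambda>s. J (w + s \<cdot>\<^sub>v h)) has_real_derivative
        h \<bullet> (M *\<^sub>v w) + t * (h \<bullet> (M *\<^sub>v h)) + d \<bullet> h + b * (\<Sum>i<n. f (p $ i + t * q $ i) * q $ i)) (at t)"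
      unfolding J_line
      by (rule derivative_eq_intros DERIV_chain2[OF F] refl | simp)+
    also have "h \<bullet> (M *\<^sub>v w) + t * (h \<bullet> (M *\<^sub>v h)) = (M *\<^sub>v (w + t \<cdot>\<^sub>v h)) \<bullet> h"
      using w h M comm_scalar_prod[of "M *\<^sub>v w" r h] comm_scalar_prod[of "M *\<^sub>v h" r h]
      by (simp add: mult_add_distrib_mat_vec mult_mat_vec add_scalar_prod_distrib[of _ r])
    also have "(\<Sum>i<n. f (p $ i + t * q $ i) * q $ i) = map_vec f (p + t \<cdot>\<^sub>v q) \<bullet> q"
      using pq by (simp add: scalar_prod_def lessThan_atLeast0)
    finally show "((\<lambda>t. J (w + t \<cdot>\<^sub>v h)) has_real_derivative T (w + t \<cdot>\<^sub>v h) \<bullet> h) (at t)"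
      using T_ip[of "w + t \<cdot>\<^sub>v h" h] w h by (simp add: line q_def)
  qed (use T \<delta> strong in auto)
  moreover have "w = w'" if "w \<in> carrier_vec r" "w' \<in> carrier_vec r" "T w = 0\<^sub>v r" "T w' = 0\<^sub>v r" for w w'
  proof -
    have "\<delta> * ((w - w') \<bullet> (w - w')) \<le> 0" using strong[OF that(1,2)] that by simp
    then have "(w - w') \<bullet> (w - w') = 0"
      using \<delta> scalar_prod_self_nonneg[of "w - w'"] by (simp add: mult_le_0_iff)
    then have "w - w' = 0\<^sub>v r"
      using that by (intro scalar_prod_self_eq_0) simp_all
    then have "(w - w') $ i = 0" if "i < r" for i using that by simp
    then show ?thesis using that(1,2) by (intro eq_vecI) auto
  qed
  ultimately show ?thesis unfolding T_def[symmetric] by blast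
qed

text \<open>The substitution \<open>u = c + Q w\<close> eliminates the kernel of \<open>Q \<Lambda> Q\<^sup>T\<close>, on which the
  equation merely fixes \<open>u\<close>.\<close>

lemma implicit_step_ex1:
  fixes L Q \<Lambda> :: "real mat" and f :: "real \<Rightarrow> real"
  assumes Q: "Q \<in> carrier_mat n r" and orth: "transpose_mat Q * Q = 1\<^sub>m r"
    and \<Lambda>: "\<Lambda> = mat_diag r lam" and lam: "\<And>i. i < r \<Longrightarrow> lam i > 0"
    and L: "L \<in> carrier_mat n n" and sym: "transpose_mat L = L" and c: "c \<in> carrier_vec n"
    and f: "continuous_on UNIV f" and b: "b \<ge> 0" and ht: "ht > 0"
    and mono: "\<And>x y. \<kappa> * (x - y)\<^sup>2 \<le> (f x - f y) * (x - y)"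
    and min: "r > 0 \<Longrightarrow> lambda_min ((1 / ht) \<cdot>\<^sub>m the (mat_inverse \<Lambda>)
        + a \<cdot>\<^sub>m (transpose_mat Q * L * Q)) + b * \<kappa> > 0"
  shows "\<exists>!u. u \<in> carrier_vec n \<and>
    u + ht \<cdot>\<^sub>v (Q * \<Lambda> * transpose_mat Q *\<^sub>v (a \<cdot>\<^sub>v (L *\<^sub>v u) + b \<cdot>\<^sub>v map_vec f u)) = c"
proof -
  define D where "D = mat_diag r (\<lambda>i. 1 / lam i)"
  have D: "D \<in> carrier_mat r r" by (simp add: D_def)
  have inv: "the (mat_inverse \<Lambda>) = D"
    using lam unfolding \<Lambda> D_def by (intro mat_inverse_mat_diag) (metis less_irrefl)
  have \<Lambda>_carrier: "\<Lambda> \<in> carrier_mat r r" by (simp add: \<Lambda>)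
  define P where "P = transpose_mat Q * L * Q"
  have P: "P \<in> carrier_mat r r" using Q L by (simp add: P_def)
  define M where "M = (1 / ht) \<cdot>\<^sub>m D + a \<cdot>\<^sub>m P"
  have M: "M \<in> carrier_mat r r" using D P by (simp add: M_def)
  have P_sym: "transpose_mat P = P"
  proof -
    have "transpose_mat P = transpose_mat Q * transpose_mat (transpose_mat Q * L)"
      unfolding P_def using Q L by (intro transpose_mult) auto
    also have "transpose_mat (transpose_mat Q * L) = L * Q"
      using transpose_mult[of "transpose_mat Q" r n L n] Q L sym by simp
    also have "transpose_mat Q * (L * Q) = P"
      unfolding P_def using Q L by (intro assoc_mult_mat[symmetric]) auto
    finally show ?thesis .
  qed
  have M_sym: "transpose_mat M = M"
  proof (rule eq_matI)
    fix i j assume "i < dim_row M" "j < dim_col M"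
    then have ij: "i < r" "j < r" using M by auto
    have "P $$ (j, i) = P $$ (i, j)"
      using arg_cong[OF P_sym, of "\<lambda>A. A $$ (i, j)"] ij P by simp
    then show "transpose_mat M $$ (i, j) = M $$ (i, j)"
      using ij P D by (simp add: M_def) (simp add: D_def mat_diag_def)
  qed (use M in auto)
  define g where "g u = a \<cdot>\<^sub>v (L *\<^sub>v u) + b \<cdot>\<^sub>v map_vec f u" for u
  have g: "g u \<in> carrier_vec n" if "u \<in> carrier_vec n" for u
    using that L by (simp add: g_def)
  \<comment> \<open>\<open>d\<close> is the part of the transpose of \<open>Q\<close> applied to
    \<open>a L u\<close> that comes from the shift \<open>c\<close>. With it \<open>T\<close> has
    the form treated in \<open>semilinear_equation_ex1\<close>, whereas \<open>T_eq\<close> regroups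
    the same terms around \<open>g\<close>.\<close>
  define d where "d = a \<cdot>\<^sub>v (transpose_mat Q *\<^sub>v (L *\<^sub>v c))"
  define T where "T w = M *\<^sub>v w + d + b \<cdot>\<^sub>v (transpose_mat Q *\<^sub>v map_vec f (c + Q *\<^sub>v w))" for w
  have T_eq: "T w = (1 / ht) \<cdot>\<^sub>v (D *\<^sub>v w) + transpose_mat Q *\<^sub>v g (c + Q *\<^sub>v w)"
    if w: "w \<in> carrier_vec r" for w
  proof -
    have Qw: "Q *\<^sub>v w \<in> carrier_vec n" using Q w by simp
    have "M *\<^sub>v w = (1 / ht) \<cdot>\<^sub>v (D *\<^sub>v w) + a \<cdot>\<^sub>v (P *\<^sub>v w)"
      unfolding M_def using D P w
      by (intro eq_vecI) (auto simp: add_scalar_prod_distrib[of _ r])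
    moreover have "P *\<^sub>v w = transpose_mat Q *\<^sub>v (L *\<^sub>v (Q *\<^sub>v w))"
      unfolding P_def using Q L w Qw
      by (simp add: assoc_mult_mat_vec[of _ r n _ r] assoc_mult_mat_vec[of _ r n _ n])
    moreover have "transpose_mat Q *\<^sub>v g (c + Q *\<^sub>v w) = a \<cdot>\<^sub>v (transpose_mat Q *\<^sub>v (L *\<^sub>v c))
        + a \<cdot>\<^sub>v (transpose_mat Q *\<^sub>v (L *\<^sub>v (Q *\<^sub>v w)))
        + b \<cdot>\<^sub>v (transpose_mat Q *\<^sub>v map_vec f (c + Q *\<^sub>v w))"
      unfolding g_def using Q L c Qw
      by (simp add: mult_add_distrib_mat_vec[of _ r n] mult_add_distrib_mat_vec[of _ n n]
          mult_mat_vec[of _ r n] smult_add_distrib_vec[of _ r] smult_add_distrib_vec[of _ n])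
    ultimately show ?thesis
      using w Q L D c by (intro eq_vecI) (auto simp: T_def d_def)
  qed
  \<comment> \<open>Each component is multiplied by the positive number \<open>ht * lam i\<close>,
    which undoes \<open>D\<close> and puts the equation in fixed-point form.\<close>
  have T_iff: "T w = 0\<^sub>v r \<longleftrightarrow> w = (- ht) \<cdot>\<^sub>v (\<Lambda> *\<^sub>v (transpose_mat Q *\<^sub>v g (c + Q *\<^sub>v w)))"
    if w: "w \<in> carrier_vec r" for w
  proof -
    define z where "z = transpose_mat Q *\<^sub>v g (c + Q *\<^sub>v w)"
    have z: "z \<in> carrier_vec r" using w Q c g by (simp add: z_def)
    have "T w = 0\<^sub>v r \<longleftrightarrow> (\<forall>i<r. w $ i / (ht * lam i) + z $ i = 0)"
      using w z by (auto simp: T_eq z_def[symmetric] D_def mat_diag_mult_vec vec_eq_iff)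
    also have "\<dots> \<longleftrightarrow> (\<forall>i<r. w $ i = - ht * (lam i * z $ i))"
    proof (intro all_cong)
      fix i assume "i < r"
      then show "w $ i / (ht * lam i) + z $ i = 0 \<longleftrightarrow> w $ i = - ht * (lam i * z $ i)"
        using lam[of i] ht by (auto simp: field_simps)
    qed
    also have "\<dots> \<longleftrightarrow> w = (- ht) \<cdot>\<^sub>v (\<Lambda> *\<^sub>v z)"
      using w z by (auto simp: \<Lambda> mat_diag_mult_vec vec_eq_iff)
    finally show ?thesis by (simp add: z_def)
  qed
  \<comment> \<open>Every solution lies in \<open>c\<close> plus the range of \<open>Q\<close>: the
    increment is \<open>Q\<close> applied to a vector computed from \<open>u\<close>.\<close>
  have step_iff: "u + ht \<cdot>\<^sub>v (Q * \<Lambda> * transpose_mat Q *\<^sub>v g u) = c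
      \<longleftrightarrow> u = c + Q *\<^sub>v ((- ht) \<cdot>\<^sub>v (\<Lambda> *\<^sub>v (transpose_mat Q *\<^sub>v g u)))"
    if u: "u \<in> carrier_vec n" for u
  proof -
    define y where "y = \<Lambda> *\<^sub>v (transpose_mat Q *\<^sub>v g u)"
    have y: "y \<in> carrier_vec r" using u Q g \<Lambda>_carrier by (simp add: y_def)
    have "Q * \<Lambda> * transpose_mat Q *\<^sub>v g u = Q *\<^sub>v y"
      unfolding y_def using Q g[OF u] \<Lambda>_carrier
      by (simp add: assoc_mult_mat_vec[of _ n r _ n] assoc_mult_mat_vec[of _ n r _ r])
    moreover have "Q *\<^sub>v ((- ht) \<cdot>\<^sub>v y) = (- ht) \<cdot>\<^sub>v (Q *\<^sub>v y)" using Q y by (rule mult_mat_vec)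
    ultimately show ?thesis
      unfolding y_def[symmetric] using u c Q y by (auto simp: vec_eq_iff algebra_simps)
  qed
  have "\<exists>!w. w \<in> carrier_vec r \<and> T w = 0\<^sub>v r"
  proof -
    \<comment> \<open>For \<open>r = 0\<close> the value of \<open>lambda_min M\<close> is
      unspecified, but all scalar products are empty sums, so any positive constant will do.\<close>
    define \<delta> where "\<delta> = (if r > 0 then lambda_min M + b * \<kappa> else 1)"
    have "\<delta> > 0" using min by (simp add: \<delta>_def M_def inv P_def)
    moreover have "\<delta> * (h \<bullet> h) \<le> h \<bullet> (M *\<^sub>v h) + b * \<kappa> * ((Q *\<^sub>v h) \<bullet> (Q *\<^sub>v h))"
      if h: "h \<in> carrier_vec r" for h
    proof (cases "r > 0")
      case True
      then show ?thesis
        using lambda_min_le_quadratic_form[OF M M_sym h] scalar_prod_isometry[OF Q orth h]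
        by (simp add: \<delta>_def algebra_simps)
    next
      case False
      then show ?thesis using h M scalar_prod_isometry[OF Q orth h] by (simp add: scalar_prod_def)
    qed
    ultimately show ?thesis
      unfolding T_def using Q L c
      by (intro semilinear_equation_ex1[OF M M_sym Q c _ f b mono]) (auto simp: d_def)
  qed
  then obtain w where w: "w \<in> carrier_vec r" "T w = 0\<^sub>v r"
    and unique: "\<And>w'. w' \<in> carrier_vec r \<Longrightarrow> T w' = 0\<^sub>v r \<Longrightarrow> w' = w" by blast
  show ?thesis unfolding g_def[symmetric]
  proof (intro ex1I conjI)
    show u: "c + Q *\<^sub>v w \<in> carrier_vec n" using w Q c by simp
    show "c + Q *\<^sub>v w + ht \<cdot>\<^sub>v (Q * \<Lambda> * transpose_mat Q *\<^sub>v g (c + Q *\<^sub>v w)) = c"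
      unfolding step_iff[OF u] using T_iff w by simp
  next
    fix u assume u: "u \<in> carrier_vec n \<and> u + ht \<cdot>\<^sub>v (Q * \<Lambda> * transpose_mat Q *\<^sub>v g u) = c"
    \<comment> \<open>The coordinates of \<open>u - c\<close> are read off from \<open>g u\<close>,
      so \<open>Q\<close> need not be inverted; \<open>T_iff\<close> then shows that they solve the
      reduced equation.\<close>
    define w' where "w' = (- ht) \<cdot>\<^sub>v (\<Lambda> *\<^sub>v (transpose_mat Q *\<^sub>v g u))"
    have w': "w' \<in> carrier_vec r" using u Q g \<Lambda>_carrier by (simp add: w'_def)
    have "u = c + Q *\<^sub>v w'" using u step_iff unfolding w'_def by blast
    moreover from this have "T w' = 0\<^sub>v r" using T_iff[OF w'] by (simp add: w'_def)
    ultimately show "u = c + Q *\<^sub>v w" using unique w' by blast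
  qed
qed

subsection \<open>Time levels\<close>

definition time_level :: "nat \<Rightarrow> real vec \<Rightarrow> nat \<Rightarrow> real vec" where
  "time_level n U t = vec n (\<lambda>i. U $ (t * n + i))"

lemma time_level_carrier [simp]: "time_level n U t \<in> carrier_vec n"
  by (simp add: time_level_def)

lemma time_level_index_less:
  assumes "t < m" and "i < n"
  shows "t * n + i < m * (n :: nat)"
proof -
  have "t * n + i < Suc t * n" using assms by simp
  also have "\<dots> \<le> m * n" using assms by (intro mult_le_mono1) simp
  finally show ?thesis .
qed

lemma time_level_eqI:
  assumes U: "U \<in> carrier_vec (m * n)" and V: "V \<in> carrier_vec (m * n)"
    and eq: "\<And>t. t < m \<Longrightarrow> time_level n U t = time_level n V t"
  shows "U = V"
proof (rule eq_vecI)
  fix k assume "k < dim_vec V"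
  then have k: "k < m * n" using V by simp
  then have n: "n > 0" by (cases n) auto
  have t: "k div n < m" using k n by (simp add: div_less_iff_less_mult)
  have "U $ k = time_level n U (k div n) $ (k mod n)" using n by (simp add: time_level_def)
  also have "\<dots> = V $ k" using eq[OF t] n by (simp add: time_level_def)
  finally show "U $ k = V $ k" .
qed (use U V in auto)

lemma sum_time_level:
  "(\<Sum>k<m * n. h k :: 'a :: comm_monoid_add) = (\<Sum>s<m. \<Sum>j<(n::nat). h (s * n + j))"
proof -
  have "(\<Sum>k<m * n. h k) = (\<Sum>s<m. sum h {s * n..<s * n + n})"
    by (rule sum.nat_group[symmetric])
  moreover have "sum h {s * n..<s * n + n} = (\<Sum>j<n. h (s * n + j))" for s
    using sum.shift_bounds_nat_ivl[of h 0 "s * n" n] by (simp add: lessThan_atLeast0 add.commute)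
  ultimately show ?thesis by simp
qed

text \<open>Writing the column index as \<open>s * n + j\<close> factors each entry of the Kronecker
  product, and the inner sum over \<open>j\<close> becomes \<open>B\<close> applied to level
  \<open>s\<close>.\<close>

lemma time_level_kron_mult:
  assumes A: "A \<in> carrier_mat m m" and B: "B \<in> carrier_mat n n"
    and U: "U \<in> carrier_vec (m * n)" and t: "t < m"
  shows "time_level n (kron A B *\<^sub>v U) t
    = vec n (\<lambda>i. \<Sum>s<m. A $$ (t, s) * (B *\<^sub>v time_level n U s) $ i)"
proof (rule eq_vecI)
  fix i assume "i < dim_vec (vec n (\<lambda>i. \<Sum>s<m. A $$ (t, s) * (B *\<^sub>v time_level n U s) $ i))"
  then have i: "i < n" by simp
  have k: "t * n + i < m * n" using time_level_index_less[OF t i] .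
  have dims: "dim_row (kron A B) = m * n" "dim_col (kron A B) = m * n"
    using A B by (auto simp: kron_def)
  have "time_level n (kron A B *\<^sub>v U) t $ i = (\<Sum>l<m * n. kron A B $$ (t * n + i, l) * U $ l)"
    using i k U dims by (simp add: time_level_def scalar_prod_def lessThan_atLeast0)
  also have "\<dots> = (\<Sum>s<m. \<Sum>j<n. kron A B $$ (t * n + i, s * n + j) * U $ (s * n + j))"
    by (rule sum_time_level)
  also have "\<dots> = (\<Sum>s<m. \<Sum>j<n. A $$ (t, s) * (B $$ (i, j) * U $ (s * n + j)))"
    using A B i k by (intro sum.cong) (auto simp: kron_def time_level_index_less)
  also have "\<dots> = (\<Sum>s<m. A $$ (t, s) * (B *\<^sub>v time_level n U s) $ i)"
    using B i
    by (simp add: time_level_def scalar_prod_def lessThan_atLeast0 sum_distrib_left)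
  finally show "time_level n (kron A B *\<^sub>v U) t $ i
    = vec n (\<lambda>i. \<Sum>s<m. A $$ (t, s) * (B *\<^sub>v time_level n U s) $ i) $ i" using i by simp
qed (simp add: time_level_def)

lemma time_level_block_diag_mult:
  assumes B: "B \<in> carrier_mat n n" and U: "U \<in> carrier_vec (m * n)" and t: "t < m"
  shows "time_level n (kron (1\<^sub>m m) B *\<^sub>v U) t = B *\<^sub>v time_level n U t"
proof (rule eq_vecI)
  fix i assume "i < dim_vec (B *\<^sub>v time_level n U t)"
  then have i: "i < n" using B by simp
  have "(\<Sum>s<m. 1\<^sub>m m $$ (t, s) * (B *\<^sub>v time_level n U s) $ i)
      = (\<Sum>s<m. if t = s then (B *\<^sub>v time_level n U s) $ i else 0)"
    using t by (intro sum.cong) auto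
  then show "time_level n (kron (1\<^sub>m m) B *\<^sub>v U) t $ i = (B *\<^sub>v time_level n U t) $ i"
    using t i by (subst time_level_kron_mult[OF one_carrier_mat B U t]) simp
qed (use B in \<open>simp add: time_level_def\<close>)

text \<open>Level 0 has the zero vector as predecessor because the initial data enter through
  \<open>V\<close>. The argument is a function of time, so that it covers both the levels of a given
  vector and a sequence still under construction.\<close>

definition previous_level :: "nat \<Rightarrow> (nat \<Rightarrow> real vec) \<Rightarrow> nat \<Rightarrow> real vec" where
  "previous_level n w t = (case t of 0 \<Rightarrow> 0\<^sub>v n | Suc s \<Rightarrow> w s)"

lemma time_level_time_diff_mult:
  assumes U: "U \<in> carrier_vec (m * n)" and t: "t < m"
  shows "time_level n (kron (time_diff_mat m) (1\<^sub>m n) *\<^sub>v U) t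
    = time_level n U t - previous_level n (time_level n U) t"
proof (rule eq_vecI)
  fix i assume "i < dim_vec (time_level n U t - previous_level n (time_level n U) t)"
  then have i: "i < n" by (auto simp: previous_level_def time_level_def split: nat.splits)
  have D: "time_diff_mat m \<in> carrier_mat m m" by (simp add: time_diff_mat_def)
  have "(\<Sum>s<m. time_diff_mat m $$ (t, s) * time_level n U s $ i)
      = (\<Sum>s<m. (if t = s then time_level n U s $ i else 0)
          - (if t = Suc s then time_level n U s $ i else 0))"
    using t by (intro sum.cong) (auto simp: time_diff_mat_def)
  also have "\<dots> = (\<Sum>s<m. if t = s then time_level n U s $ i else 0)
      - (\<Sum>s<m. if t = Suc s then time_level n U s $ i else 0)"
    by (rule sum_subtractf)
  \<comment> \<open>For \<open>t = 0\<close> no \<open>s\<close> satisfies \<open>t = Suc s\<close>;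
    the empty second sum matches the zero predecessor.\<close>
  also have "\<dots> = time_level n U t $ i - previous_level n (time_level n U) t $ i"
    using t i by (cases t) (simp_all add: previous_level_def)
  finally show "time_level n (kron (time_diff_mat m) (1\<^sub>m n) *\<^sub>v U) t $ i
      = (time_level n U t - previous_level n (time_level n U) t) $ i"
    using i by (subst time_level_kron_mult[OF D one_carrier_mat U t])
      (simp add: previous_level_def time_level_def split: nat.splits)
qed (simp add: time_level_def previous_level_def split: nat.splits)

section \<open>Decoupling of the space-time equation and forward substitution\<close>

lemma kron_mult_carrier:
  "A \<in> carrier_mat m m \<Longrightarrow> B \<in> carrier_mat n n \<Longrightarrow> kron A B *\<^sub>v U \<in> carrier_vec (m * n)"
  by (intro carrier_vecI) (simp add: kron_def)

lemma time_level_add: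
  "U \<in> carrier_vec (m * n) \<Longrightarrow> V \<in> carrier_vec (m * n) \<Longrightarrow> t < m \<Longrightarrow>
    time_level n (U + V) t = time_level n U t + time_level n V t"
  by (intro eq_vecI) (auto simp: time_level_def time_level_index_less)

lemma time_level_minus:
  "U \<in> carrier_vec (m * n) \<Longrightarrow> V \<in> carrier_vec (m * n) \<Longrightarrow> t < m \<Longrightarrow>
    time_level n (U - V) t = time_level n U t - time_level n V t"
  by (intro eq_vecI) (auto simp: time_level_def time_level_index_less)

lemma time_level_smult:
  "U \<in> carrier_vec (m * n) \<Longrightarrow> t < m \<Longrightarrow> time_level n (k \<cdot>\<^sub>v U) t = k \<cdot>\<^sub>v time_level n U t"
  by (intro eq_vecI) (auto simp: time_level_def time_level_index_less)

lemma time_level_map_vec: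
  "U \<in> carrier_vec (m * n) \<Longrightarrow> t < m \<Longrightarrow> time_level n (map_vec f U) t = map_vec f (time_level n U t)"
  by (intro eq_vecI) (auto simp: time_level_def time_level_index_less)

lemma time_level_zero: "t < m \<Longrightarrow> time_level n (0\<^sub>v (m * n)) t = 0\<^sub>v n"
  by (intro eq_vecI) (auto simp: time_level_def time_level_index_less)

text \<open>Apart from the time difference every operator is block diagonal or acts entrywise, so a
  level is coupled only to its predecessor, which moves to the right-hand side.\<close>

lemma scheme_map_eq_0_iff:
  assumes G: "G \<in> carrier_mat n n" and L: "L \<in> carrier_mat n n"
    and V: "V \<in> carrier_vec (Nt * n)" and U: "U \<in> carrier_vec (Nt * n)"
  shows "scheme_map Nt n ht G L a b f V U = 0\<^sub>v (Nt * n) \<longleftrightarrow>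
    (\<forall>t<Nt. time_level n U t
        + ht \<cdot>\<^sub>v (G *\<^sub>v (a \<cdot>\<^sub>v (L *\<^sub>v time_level n U t) + b \<cdot>\<^sub>v map_vec f (time_level n U t)))
      = time_level n V t + previous_level n (time_level n U) t)"
    (is "?F = _ \<longleftrightarrow> (\<forall>t<Nt. ?E t)")
proof -
  have D: "time_diff_mat Nt \<in> carrier_mat Nt Nt" by (simp add: time_diff_mat_def)
  note carrier = kron_mult_carrier[OF D one_carrier_mat] kron_mult_carrier[OF one_carrier_mat G]
    kron_mult_carrier[OF one_carrier_mat L]
  have F: "?F \<in> carrier_vec (Nt * n)" using U V carrier by (simp add: scheme_map_def)
  have "?F = 0\<^sub>v (Nt * n) \<longleftrightarrow> (\<forall>t<Nt. time_level n ?F t = 0\<^sub>v n)"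
    using time_level_eqI[OF F zero_carrier_vec] by (auto simp: time_level_zero)
  also have "\<dots> \<longleftrightarrow> (\<forall>t<Nt. ?E t)"
  proof (intro all_cong)
    fix t assume t: "t < Nt"
    let ?g = "ht \<cdot>\<^sub>v (G *\<^sub>v (a \<cdot>\<^sub>v (L *\<^sub>v time_level n U t) + b \<cdot>\<^sub>v map_vec f (time_level n U t)))"
    have p: "previous_level n (time_level n U) t \<in> carrier_vec n"
      by (simp add: previous_level_def split: nat.split)
    have g: "?g \<in> carrier_vec n" using G L by simp
    have "time_level n ?F t = time_level n U t - previous_level n (time_level n U) t + ?g - time_level n V t"
      unfolding scheme_map_def using t U V G L carrier
      by (simp add: time_level_minus[of _ Nt] time_level_add[of _ Nt] time_level_smult[of _ Nt]
          time_level_map_vec[of _ Nt] time_level_block_diag_mult time_level_time_diff_mult)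
    moreover have "x - y + z - v = 0\<^sub>v n \<longleftrightarrow> x + z = v + y"
      if "x \<in> carrier_vec n" "y \<in> carrier_vec n" "z \<in> carrier_vec n" "v \<in> carrier_vec n"
      for x y z v :: "real vec"
      using that by (auto simp: vec_eq_iff algebra_simps)
    ultimately show "time_level n ?F t = 0\<^sub>v n \<longleftrightarrow> ?E t"
      using p g by simp
  qed
  finally show ?thesis .
qed

lemma block_recursion_ex1:
  assumes step: "\<And>c. c \<in> carrier_vec n \<Longrightarrow> \<exists>!u. u \<in> carrier_vec n \<and> S u = c"
  shows "\<exists>!U. U \<in> carrier_vec (m * n) \<and>
    (\<forall>t<m. S (time_level n U t) = time_level n V t + previous_level n (time_level n U) t)"
proof -
  define sol where "sol c = (THE u. u \<in> carrier_vec n \<and> S u = c)" for c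
  have sol: "sol c \<in> carrier_vec n" "S (sol c) = c" if "c \<in> carrier_vec n" for c
    using theI'[OF step[OF that]] by (auto simp: sol_def)
  \<comment> \<open>The base case adds \<open>0\<^sub>v n\<close> so that it has the same right-hand
    side as in \<open>previous_level\<close>.\<close>
  define w where "w = rec_nat (sol (time_level n V 0 + 0\<^sub>v n)) (\<lambda>t u. sol (time_level n V (Suc t) + u))"
  have w: "w t \<in> carrier_vec n \<and> S (w t) = time_level n V t + previous_level n w t" for t
    by (induction t) (simp_all add: w_def previous_level_def sol)
  define U where "U = vec (m * n) (\<lambda>k. w (k div n) $ (k mod n))"
  have level: "time_level n U t = w t" if "t < m" for t
    using that w[of t] by (intro eq_vecI) (auto simp: time_level_def U_def time_level_index_less)
  have previous_cong: "previous_level n x t = previous_level n y t"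
    if "\<And>s. s < t \<Longrightarrow> x s = y s" for x y t
    using that by (cases t) (simp_all add: previous_level_def)
  show ?thesis
  proof (intro ex1I conjI allI impI)
    show "U \<in> carrier_vec (m * n)" by (simp add: U_def)
    fix t assume t: "t < m"
    have "previous_level n (time_level n U) t = previous_level n w t"
      using t by (intro previous_cong level) simp
    then show "S (time_level n U t) = time_level n V t + previous_level n (time_level n U) t"
      using w level[OF t] by simp
  next
    fix U' assume U': "U' \<in> carrier_vec (m * n) \<and>
      (\<forall>t<m. S (time_level n U' t) = time_level n V t + previous_level n (time_level n U') t)"
    \<comment> \<open>If all earlier levels agree, both vectors solve the step equation with the
      same right-hand side, and uniqueness of the step applies.\<close>
    have "time_level n U' t = w t" if "t < m" for t
      using that
    proof (induction t rule: less_induct)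
      case (less t)
      have "previous_level n (time_level n U') t = previous_level n w t"
        using less by (intro previous_cong) simp
      then have "S (time_level n U' t) = S (w t)" using U' w less.prems by simp
      moreover have "S (w t) \<in> carrier_vec n"
        using w[of t] w by (auto simp: previous_level_def split: nat.split)
      ultimately show ?case using step w time_level_carrier by metis
    qed
    then have "time_level n U' t = time_level n U t" if "t < m" for t
      using level[OF that] that by simp
    moreover have "U' \<in> carrier_vec (m * n)" "U \<in> carrier_vec (m * n)"
      using U' by (simp_all add: U_def)
    ultimately show "U' = U" by (rule time_level_eqI[rotated 2])
  qed
qed

theorem theorem1:
  fixes a b ht K :: real
    and Nt Nx n r :: nat
    and G L Q1 Q2 \<Lambda> :: "real mat"
    and lam :: "nat \<Rightarrow> real"
    and f W \<phi> :: "real \<Rightarrow> real"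
    and V :: "real vec"
  assumes "a \<ge> 0" and "b \<ge> 0" and "ht > 0"
    and "Nt > 0" and "Nx > 0" and "n = Nx\<^sup>2"
    and "G \<in> carrier_mat n n" and "self_adjoint_mat G" and "pos_semidef_mat G"
    and "L \<in> carrier_mat n n" and "self_adjoint_mat L" and "pos_semidef_mat L"
    and "r = vec_space.rank n G"
    and "Q1 \<in> carrier_mat n r" and "Q2 \<in> carrier_mat n (n - r)"
    and "orthonormal_mat (hcat Q1 Q2)"
    and "\<Lambda> = mat_diag r lam"
    and "\<And>i j. i \<le> j \<Longrightarrow> j < r \<Longrightarrow> lam j \<le> lam i"
    and "\<And>i. i < r \<Longrightarrow> lam i > 0"
    and "G = hcat Q1 Q2
             * four_block_mat \<Lambda> (0\<^sub>m r (n - r)) (0\<^sub>m (n - r) r) (0\<^sub>m (n - r) (n - r))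
             * (transpose_mat Q1 @\<^sub>r transpose_mat Q2)"
    and "f C1_differentiable_on UNIV"
    and "\<And>x. f x = deriv W x + \<phi> x"
    and "W C1_differentiable_on UNIV" and "convex_on UNIV W"
    and "continuous_on UNIV \<phi>" and "\<exists>C. C-lipschitz_on UNIV \<phi>"
    and "K \<ge> 0"
    and "\<And>x y. (deriv W x - deriv W y) * (x - y) \<ge> K * \<bar>x - y\<bar>\<^sup>2"
    \<comment> \<open>for \<open>r = 0\<close> the matrix below is \<open>0 \<times> 0\<close>, its smallest eigenvalue counts as \<open>\<infinity>\<close>, and
      the condition is void\<close>
    and "r > 0 \<Longrightarrow>
           lambda_min ((1 / ht) \<cdot>\<^sub>m the (mat_inverse \<Lambda>) + a \<cdot>\<^sub>m (transpose_mat Q1 * L * Q1)) + b * K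
             > b * Lip \<phi>"
    and "V \<in> carrier_vec (Nt * n)"
  shows "\<exists>!U. U \<in> carrier_vec (Nt * n) \<and> scheme_map Nt n ht G L a b f V U = 0\<^sub>v (Nt * n)"
proof -
  note b = assms(2) and ht = assms(3)
    and G = assms(7) and L = assms(10) and Q1 = assms(14) and Q2 = assms(15)
    and orth = assms(16) and \<Lambda> = assms(17) and lam = assms(19) and G_eq = assms(20)
    and C1 = assms(21) and f_eq = assms(22) and \<phi> = assms(26) and W_mono = assms(28)
    and min = assms(29) and V = assms(30)
  have L_sym: "transpose_mat L = L" using assms(11) by (simp add: self_adjoint_mat_def)
  have Q1_orth: "transpose_mat Q1 * Q1 = 1\<^sub>m r"
    using orthonormal_hcat[OF Q1 Q2 orth] .
  have G_Q1: "G = Q1 * \<Lambda> * transpose_mat Q1"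
    unfolding G_eq by (rule hcat_block_diag_product[OF Q1 Q2]) (simp add: \<Lambda>)
  have f: "continuous_on UNIV f"
    using C1 by (intro differentiable_imp_continuous_on)
      (auto simp: C1_differentiable_on_eq differentiable_on_def differentiable_at_withinI)
  \<comment> \<open>In the worst case \<open>\<phi>\<close> lowers the monotonicity constant of
    \<open>W'\<close> by \<open>Lip \<phi>\<close>. With \<open>\<kappa> = K - Lip \<phi>\<close>
    the condition on \<open>ht\<close> says that the smallest eigenvalue plus
    \<open>b * \<kappa>\<close> is positive.\<close>
  have mono: "(K - Lip \<phi>) * (x - y)\<^sup>2 \<le> (f x - f y) * (x - y)" for x y
  proof -
    have "\<bar>(\<phi> x - \<phi> y) * (x - y)\<bar> \<le> Lip \<phi> * \<bar>x - y\<bar> * \<bar>x - y\<bar>"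
      using lipschitz_Lip[OF \<phi>, of x y] by (simp add: abs_mult mult_right_mono)
    then have "- (Lip \<phi> * (x - y)\<^sup>2) \<le> (\<phi> x - \<phi> y) * (x - y)"
      by (simp add: abs_le_iff power2_eq_square mult.assoc)
    then show ?thesis using W_mono[of x y] by (simp add: f_eq algebra_simps)
  qed
  let ?step = "\<lambda>u. u + ht \<cdot>\<^sub>v (G *\<^sub>v (a \<cdot>\<^sub>v (L *\<^sub>v u) + b \<cdot>\<^sub>v map_vec f u))"
  have step: "\<exists>!u. u \<in> carrier_vec n \<and> ?step u = c" if c: "c \<in> carrier_vec n" for c
    unfolding G_Q1
    by (rule implicit_step_ex1[OF Q1 Q1_orth \<Lambda> lam L L_sym c f b ht mono])
      (use min in \<open>simp_all add: algebra_simps\<close>)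
  show ?thesis
    \<comment> \<open>The levelwise reformulation holds only for vectors of the right dimension, so
      it is rewritten under the carrier condition by \<open>conj_cong\<close>.\<close>
    using block_recursion_ex1[OF step, of Nt V] scheme_map_eq_0_iff[OF G L V]
    by (simp cong: conj_cong)
qed

end
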